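(* Let $\ell \geq 2$ and let $a_i, b_i$ ($i = 1, \dots, \ell$) be positive integers with $a_i \geq 2$ for all $i \geq 1$ and $b_2 \geq 2$. Suppose $$G = (K_{a_1} \cup K_{b_1}) \,\dot{\vee}\, (K_{a_2} \cup K_{b_2}) \vee \dots \vee (K_{a_\ell} \cup K_{b_\ell}).$$ Then $q(G) = 2$ and $MB(G) = 3$.
   Context: All graphs are finite and simple. For a graph $G$ on $n$ vertices, $\mathcal{S}(G)$ is the set of real symmetric $n\times n$ matrices (indexed by the vertices) such that for distinct vertices $u,v$ the $(u,v)$ entry is nonzero if and only if $uv$ is an edge of $G$; the diagonal entries are arbitrary. $q(A)$ is the number of distinct eigenvalues of $A$, and $q(G)=\min\{q(A): A\in\mathcal{S}(G)\}$. A graph $G$ on $n$ vertices achieves the multiplicity bipartition $[n-k,k]$, where $1\le k\leq\lfloor n/2\rfloor$, if some $A\in\mathcal{S}(G)$ has exactly two distinct eigenvalues, with multiplicities $n-k$ and $k$. For a graph $G$ with $q(G)=2$, $MB(G)$ is the least integer $k\leq \lfloor n/2\rfloor$ such that $G$ achieves $[n-k,k]$. $\vee$ denotes the join of graphs (disjoint union plus all edges between the factors), $\cup$ denotes disjoint union, and $K_a$ is the complete graph on $a$ vertices. The graph $(K_{a_1} \cup K_{b_1}) \,\dot{\vee}\, (K_{a_2} \cup K_{b_2})$ is the join of $K_{a_1}\cup K_{b_1}$ and $K_{a_2}\cup K_{b_2}$ with two disjoint edges (edges sharing no endpoint) between $K_{a_1}$ and $K_{a_2}$ removed; the result is then joined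 in the ordinary way with the remaining factors. *)

theory Defs
  imports "Jordan_Normal_Form.Spectral_Radius"
begin

datatype 'a graph = Graph (verts: "'a set") (edges: "'a set set")

definition simple_graph :: "'a graph \<Rightarrow> bool" where
  "simple_graph G \<longleftrightarrow> finite (verts G) \<and> (\<forall>e \<in> edges G. e \<subseteq> verts G \<and> card e = 2)"

definition isomorphic :: "'a graph \<Rightarrow> 'b graph \<Rightarrow> bool" where
  "isomorphic G H \<longleftrightarrow> (\<exists>f. bij_betw f (verts G) (verts H) \<and>
     (\<forall>u \<in> verts G. \<forall>v \<in> verts G. {u, v} \<in> edges G \<longleftrightarrow> {f u, f v} \<in> edges H))"

definition complete_graph :: "nat \<Rightarrow> nat graph" where
  "complete_graph n = Graph {..<n} {{u, v} | u v. u < n \<and> v < n \<and> u \<noteq> v}"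

definition disjoint_union :: "'a graph \<Rightarrow> 'b graph \<Rightarrow> ('a + 'b) graph" where
  "disjoint_union G H =
     Graph (verts G <+> verts H) ((`) Inl ` edges G \<union> (`) Inr ` edges H)"

definition graph_join :: "'a graph \<Rightarrow> 'b graph \<Rightarrow> ('a + 'b) graph" where
  "graph_join G H = Graph (verts G <+> verts H)
     (edges (disjoint_union G H) \<union> {{Inl u, Inr v} | u v. u \<in> verts G \<and> v \<in> verts H})"

text \<open>The join of a family of graphs; it is the graph without vertices if the index set is empty.\<close>

definition family_join :: "'i set \<Rightarrow> ('i \<Rightarrow> 'a graph) \<Rightarrow> ('i \<times> 'a) graph" where
  "family_join I F = Graph (Sigma I (\<lambda>i. verts (F i)))
     ((\<Union>i \<in> I. (`) (Pair i) ` edges (F i)) \<union>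
      {{(i, u), (j, v)} | i j u v. i \<in> I \<and> j \<in> I \<and> i \<noteq> j \<and> u \<in> verts (F i) \<and> v \<in> verts (F j)})"

definition delete_edges :: "'a graph \<Rightarrow> 'a set set \<Rightarrow> 'a graph" where
  "delete_edges G D = Graph (verts G) (edges G - D)"

definition two_cliques :: "nat \<Rightarrow> nat \<Rightarrow> (nat + nat) graph" where
  "two_cliques a b = disjoint_union (complete_graph a) (complete_graph b)"

text \<open>
  The dotted join depends on the choice of the two removed edges, so it is rendered as the set of
  all graphs arising from such a choice. These are all isomorphic to one another.
\<close>

definition clique_cross_edges :: "nat \<Rightarrow> nat \<Rightarrow> ((nat + nat) + (nat + nat)) set set" where
  "clique_cross_edges a1 a2 = {{Inl (Inl x), Inr (Inl y)} | x y.
     x \<in> verts (complete_graph a1) \<and> y \<in> verts (complete_graph a2)}"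

definition dotted_joins ::
  "nat \<Rightarrow> nat \<Rightarrow> nat \<Rightarrow> nat \<Rightarrow> ((nat + nat) + (nat + nat)) graph set" where
  "dotted_joins a1 b1 a2 b2 =
     {delete_edges (graph_join (two_cliques a1 b1) (two_cliques a2 b2)) {e, e'} | e e'.
        e \<in> clique_cross_edges a1 a2 \<and> e' \<in> clique_cross_edges a1 a2 \<and> e \<inter> e' = {}}"

text \<open>
  Matrices have rows and columns numbered from \<open>0\<close>, so \<open>sym_matrices G\<close>, the set $\mathcal{S}(G)$,
  refers to an enumeration \<open>f\<close> of the vertices. All enumerations are admitted, which closes the
  set under simultaneous permutations of rows and columns and does not affect spectra.
\<close>

definition sym_matrices :: "'a graph \<Rightarrow> real mat set" where
  "sym_matrices G = {A. A \<in> carrier_mat (card (verts G)) (card (verts G)) \<and> A\<^sup>T = A \<and>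
     (\<exists>f. bij_betw f {..<card (verts G)} (verts G) \<and>
        (\<forall>i < card (verts G). \<forall>j < card (verts G). i \<noteq> j \<longrightarrow>
           (A $$ (i, j) \<noteq> 0 \<longleftrightarrow> {f i, f j} \<in> edges G)))}"

definition num_eigenvalues :: "real mat \<Rightarrow> nat" where
  "num_eigenvalues A = card (spectrum A)"

definition min_num_eigenvalues :: "'a graph \<Rightarrow> nat" where
  "min_num_eigenvalues G = (LEAST m. \<exists>A \<in> sym_matrices G. num_eigenvalues A = m)"

definition eigenvalue_multiplicity :: "real mat \<Rightarrow> real \<Rightarrow> nat" where
  "eigenvalue_multiplicity A x = order x (char_poly A)"

definition achieves_bipartition :: "'a graph \<Rightarrow> nat \<Rightarrow> bool" where
  "achieves_bipartition G k \<longleftrightarrow> 1 \<le> k \<and> k \<le> card (verts G) div 2 \<and>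
     (\<exists>A \<in> sym_matrices G. \<exists>x y. x \<noteq> y \<and> spectrum A = {x, y} \<and>
        eigenvalue_multiplicity A x = card (verts G) - k \<and> eigenvalue_multiplicity A y = k)"

text \<open>Meaningful only for graphs \<open>G\<close> with \<open>min_num_eigenvalues G = 2\<close>.\<close>

definition MB :: "'a graph \<Rightarrow> nat" where
  "MB G = (LEAST k. achieves_bipartition G k)"

end

theory Submission
  imports Defs
begin

text \<open>
  A matrix in \<open>S(G)\<close> with two eigenvalues is, up to shift and scaling, an orthogonal projection,
  so \<open>G\<close> achieves $[n-k,k]$ iff its vertices carry vectors in $\mathbb{R}^k$ that form a tight
  frame and are orthogonal exactly for nonadjacent pairs. Let $xy$ and $x'y'$ be the removed edges
  and $z$ a vertex of $K_{b_1}$. In dimension at most $2$, orthogonality of the pairs $xz$, $xy$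
  and $x'z$ forces that of the edge $x'y$, which rules out $k \le 2$. In dimension $3$ an explicit
  tight frame exists. A matrix with a single eigenvalue is scalar, hence $q(G) \ge 2$.
\<close>

text \<open>For the ordinary join the plane would suffice: give each group two orthogonal lines,
  with different slopes for different groups, and scale the second clique so that every group is
  tight by itself. Removing edges between two groups has to create orthogonality there and nowhere
  else, which is the purpose of the third coordinate. The two removed edges allow opposite heights
  within each of the two cliques; the heights then sum to zero and the third direction stays
  orthogonal to the plane. Cancelling the removed edges fixes only the product of two heights
  \<open>r\<close> and \<open>s\<close>. The remaining freedom is spent on
  \<open>r\<^sup>2 + s\<^sup>2\<close>, so that the third direction gets the same squared norm
  \<open>T\<close> as the planar ones. The danger left is an accidental orthogonality between the
  two lifted vertices of one clique; it would force \<open>T\<close> to be 4 or 5, while every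
  admissible choice of sizes gives \<open>T \<ge> 6\<close>.\<close>

section \<open>Spectral theorem for real symmetric matrices\<close>

text \<open>Over the complex numbers an eigenvector \<open>v\<close> exists. Its Hermitian form
  \<open>t\<close> and its squared norm \<open>s\<close> are both real, and \<open>t = k * s\<close>
  with \<open>s \<noteq> 0\<close>, so \<open>k\<close> is a real root of the characteristic
  polynomial.\<close>

lemma symmetric_mat_exists_eigenvalue:
  fixes A :: "real mat"
  assumes A: "A \<in> carrier_mat n n" and sym: "A\<^sup>T = A" and n: "n \<noteq> 0"
  shows "\<exists>e. eigenvalue A e"
proof -
  let ?C = "map_mat complex_of_real A"
  have C: "?C \<in> carrier_mat n n" using A by simp
  obtain k where "eigenvalue ?C k"
    using spectrum_non_empty[OF C] n unfolding spectrum_def by auto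
  then obtain v where v: "v \<in> carrier_vec n" and v0: "v \<noteq> 0\<^sub>v n"
    and ev: "?C *\<^sub>v v = k \<cdot>\<^sub>v v"
    unfolding eigenvalue_def eigenvector_def using C by auto
  have symA: "A $$ (i, j) = A $$ (j, i)" if "i < n" "j < n" for i j
    using arg_cong[OF sym, of "\<lambda>M. M $$ (i, j)"] that A by simp
  define s where "s = (\<Sum>i<n. cnj (v $ i) * v $ i)"
  define t where "t = (\<Sum>i<n. \<Sum>j<n. cnj (v $ i) * (of_real (A $$ (i, j)) * v $ j))"
  have Cv: "(\<Sum>j<n. of_real (A $$ (i, j)) * v $ j) = k * v $ i" if "i < n" for i
    using arg_cong[OF ev, of "\<lambda>w. w $ i"] that A v
    by (simp add: scalar_prod_def atLeast0LessThan)
  have t: "t = k * s"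
    unfolding t_def s_def by (simp add: sum_distrib_left[symmetric] Cv)
      (simp add: sum_distrib_left algebra_simps)
  have "cnj t = t"
    unfolding t_def
    by (subst sum.swap) (auto simp: cnj_sum intro!: sum.cong simp: symA)
  have "s = of_real (\<Sum>i<n. (cmod (v $ i))\<^sup>2)"
    unfolding s_def by (simp add: complex_norm_square mult.commute del: of_real_power)
  moreover have "(\<Sum>i<n. (cmod (v $ i))\<^sup>2) \<noteq> 0"
  proof
    assume "(\<Sum>i<n. (cmod (v $ i))\<^sup>2) = 0"
    then have "\<forall>i<n. v $ i = 0" by (simp add: sum_nonneg_eq_0_iff)
    then show False using v v0 by auto
  qed
  ultimately have s0: "s \<noteq> 0" and "cnj s = s" by (simp_all flip: of_real_sum)
  with \<open>cnj t = t\<close> t have "cnj k = k" by simp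
  then obtain r where r: "k = of_real r" by (metis complex_cnj_cancel_iff Reals_cnj_iff Reals_cases)
  have "poly (char_poly ?C) k = 0"
    using \<open>eigenvalue ?C k\<close> eigenvalue_root_char_poly[OF C] by simp
  then have "poly (char_poly A) r = 0"
    unfolding r of_real_hom.char_poly_hom[OF A] by simp
  then show ?thesis using eigenvalue_root_char_poly[OF A] by blast
qed

text \<open>Gram-Schmidt leaves the first vector of a basis unchanged, so normalising the result
  only rescales \<open>v\<close>; the constant \<open>c\<close> is the reciprocal of its
  norm.\<close>

lemma orthonormal_completion:
  fixes v :: "real vec"
  assumes v: "v \<in> carrier_vec n" and v0: "v \<noteq> 0\<^sub>v n" and n: "0 < n"
  obtains W c where "W \<in> carrier_mat n n" "W\<^sup>T * W = 1\<^sub>m n" "col W 0 = c \<cdot>\<^sub>v v"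
proof -
  interpret cof_vec_space n "TYPE(real)" .
  define ws where "ws = gram_schmidt n (basis_completion v)"
  note b = basis_completion[OF v v0]
  note g = gram_schmidt_result[OF b(2) b(4) b(5) ws_def]
  have len: "length ws = n" using g(4) b(6) by simp
  have hd: "ws ! 0 = v"
  proof -
    obtain vs where vs: "basis_completion v = v # vs"
      unfolding basis_completion_def Let_def by blast
    have "hd ws = v" unfolding ws_def vs by (rule gram_schmidt_hd[OF v])
    then show ?thesis using len n by (cases ws) auto
  qed
  have car: "ws ! i \<in> carrier_vec n" if "i < n" for i using g(3) len that by auto
  have orth: "ws ! i \<bullet> ws ! j = 0 \<longleftrightarrow> i \<noteq> j" if "i < n" "j < n" for i j
    using corthogonalD[OF g(2)] len that by simp
  define W where "W = mat n n (\<lambda>(i, j). ws ! j $ i / sqrt (ws ! j \<bullet> ws ! j))"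
  have W: "W \<in> carrier_mat n n" unfolding W_def by simp
  have col: "col W j = (1 / sqrt (ws ! j \<bullet> ws ! j)) \<cdot>\<^sub>v ws ! j" if "j < n" for j
    using car[OF that] that unfolding W_def by (intro eq_vecI) auto
  have "W\<^sup>T * W = 1\<^sub>m n"
  proof (rule eq_matI)
    fix i j assume "i < dim_row (1\<^sub>m n :: real mat)" "j < dim_col (1\<^sub>m n :: real mat)"
    then have i: "i < n" and j: "j < n" by auto
    have nn: "0 \<le> ws ! i \<bullet> ws ! i" unfolding scalar_prod_def by (simp add: sum_nonneg)
    have "(W\<^sup>T * W) $$ (i, j) = col W i \<bullet> col W j" using i j W by simp
    also have "\<dots> = ws ! i \<bullet> ws ! j / (sqrt (ws ! i \<bullet> ws ! i) * sqrt (ws ! j \<bullet> ws ! j))"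
      using car[OF i] car[OF j] by (simp add: col i j)
    also have "\<dots> = 1\<^sub>m n $$ (i, j)"
      using orth[OF i j] i j nn by (cases "i = j") auto
    finally show "(W\<^sup>T * W) $$ (i, j) = 1\<^sub>m n $$ (i, j)" .
  qed (use W in auto)
  with that W col[OF n] hd show thesis by auto
qed

text \<open>Deflation: in an orthonormal basis starting with an eigenvector the matrix splits into a
  1 by 1 block and a smaller symmetric block, to which the induction hypothesis applies.\<close>

theorem symmetric_mat_diagonalization:
  fixes A :: "real mat"
  assumes "A \<in> carrier_mat n n" and "A\<^sup>T = A"
  obtains U d where "U \<in> carrier_mat n n" "U\<^sup>T * U = 1\<^sub>m n" "A = U * mat_diag n d * U\<^sup>T"
proof -
  have "\<exists>U d. U \<in> carrier_mat n n \<and> U\<^sup>T * U = 1\<^sub>m n \<and> A = U * mat_diag n d * U\<^sup>T"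
    using assms
  proof (induction n arbitrary: A)
    case 0
    then show ?case by (intro exI[of _ "1\<^sub>m 0"] exI[of _ "\<lambda>_. 0"]) auto
  next
    case (Suc n)
    note A = Suc.prems(1) and sym = Suc.prems(2)
    obtain e where "eigenvalue A e" using symmetric_mat_exists_eigenvalue[OF A sym] by auto
    then obtain v where v: "v \<in> carrier_vec (Suc n)" "v \<noteq> 0\<^sub>v (Suc n)" "A *\<^sub>v v = e \<cdot>\<^sub>v v"
      unfolding eigenvalue_def eigenvector_def using A by auto
    obtain W c where W: "W \<in> carrier_mat (Suc n) (Suc n)" and WW: "W\<^sup>T * W = 1\<^sub>m (Suc n)"
      and col0: "col W 0 = c \<cdot>\<^sub>v v"
      using orthonormal_completion[OF v(1,2)] by auto
    have WW': "W * W\<^sup>T = 1\<^sub>m (Suc n)" using mat_mult_left_right_inverse[OF _ W WW] W by simp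
    define B where "B = W\<^sup>T * A * W"
    note assoc = assoc_mult_mat[of _ "Suc n" "Suc n" _ "Suc n" _ "Suc n"]
    have B: "B \<in> carrier_mat (Suc n) (Suc n)" unfolding B_def using W A by simp
    have symB: "B\<^sup>T = B"
      unfolding B_def using W A sym
      by (simp add: transpose_mult[of _ "Suc n" "Suc n" _ "Suc n"] assoc)
    have Bij: "B $$ (i, j) = B $$ (j, i)" if "i < Suc n" "j < Suc n" for i j
      using arg_cong[OF symB, of "\<lambda>M. M $$ (i, j)"] that B by simp
    have Bcol: "B $$ (i, 0) = (if i = 0 then e else 0)" if i: "i < Suc n" for i
    proof -
      have "A *\<^sub>v col W 0 = e \<cdot>\<^sub>v col W 0"
        unfolding col0 using v A by (simp add: mult_mat_vec smult_smult_assoc mult.commute)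
      moreover have "B $$ (i, 0) = col W i \<bullet> (A *\<^sub>v col W 0)"
      proof -
        have "B = W\<^sup>T * (A * W)" unfolding B_def using W A by (simp add: assoc)
        moreover have "col (A * W) 0 = A *\<^sub>v col W 0" using W A by auto
        ultimately show ?thesis using W A i by simp
      qed
      ultimately have "B $$ (i, 0) = e * (col W i \<bullet> col W 0)"
        using W by simp
      also have "col W i \<bullet> col W 0 = (W\<^sup>T * W) $$ (i, 0)" using W i by simp
      finally show ?thesis using WW i by simp
    qed
    \<comment> \<open>The first column of \<open>B\<close> vanishes below the diagonal because it is
      the image of an eigenvector; by symmetry the first row vanishes too, and \<open>C\<close> is
      all that is left.\<close>
    define C where "C = mat n n (\<lambda>(i, j). B $$ (Suc i, Suc j))"
    have C: "C \<in> carrier_mat n n" "C\<^sup>T = C"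
      unfolding C_def by (auto intro!: eq_matI simp: Bij)
    obtain V d where V: "V \<in> carrier_mat n n" "V\<^sup>T * V = 1\<^sub>m n" "C = V * mat_diag n d * V\<^sup>T"
      using Suc.IH[OF C] by blast
    define E where "E = mat_diag 1 (\<lambda>_. e)"
    define X where "X = four_block_mat (1\<^sub>m 1) (0\<^sub>m 1 n) (0\<^sub>m n 1) V"
    define d' where "d' = case_nat e d"
    have E: "E \<in> carrier_mat 1 1" unfolding E_def by simp
    have X: "X \<in> carrier_mat (Suc n) (Suc n)" unfolding X_def using V(1) by auto
    note block = mult_four_block_mat[where ?nr1.0 = 1 and ?n1.0 = 1 and ?n2.0 = n
        and ?nr2.0 = n and ?nc1.0 = 1 and ?nc2.0 = n]
      left_mult_zero_mat[of _ n n] right_mult_zero_mat[of _ n n]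
    have XT: "X\<^sup>T = four_block_mat (1\<^sub>m 1) (0\<^sub>m 1 n) (0\<^sub>m n 1) (V\<^sup>T)"
      unfolding X_def by (subst transpose_four_block_mat) (use V(1) in \<open>auto simp: transpose_one\<close>)
    have D: "mat_diag (Suc n) d' = four_block_mat E (0\<^sub>m 1 n) (0\<^sub>m n 1) (mat_diag n d)"
      unfolding E_def d'_def by (rule eq_matI) (auto simp: mat_diag_def split: nat.splits)
    have VD: "V * mat_diag n d \<in> carrier_mat n n" "V * mat_diag n d * V\<^sup>T \<in> carrier_mat n n"
      using V(1) by (auto intro!: mult_carrier_mat[of _ n n])
    have "B = four_block_mat E (0\<^sub>m 1 n) (0\<^sub>m n 1) C"
    proof (rule eq_matI)
      fix i j
      assume "i < dim_row (four_block_mat E (0\<^sub>m 1 n) (0\<^sub>m n 1) C)"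
        "j < dim_col (four_block_mat E (0\<^sub>m 1 n) (0\<^sub>m n 1) C)"
      then have "i < Suc n" "j < Suc n" using E C by auto
      then show "B $$ (i, j) = four_block_mat E (0\<^sub>m 1 n) (0\<^sub>m n 1) C $$ (i, j)"
        using E C(1) Bcol[of i] Bcol[of j] Bij[of 0 j]
        by (cases i; cases j) (auto simp: E_def C_def mat_diag_def)
    qed (use B E C in auto)
    also have "\<dots> = X * mat_diag (Suc n) d' * X\<^sup>T"
      unfolding XT D unfolding X_def using V E VD
      by (simp add: block)
    finally have BX: "B = X * mat_diag (Suc n) d' * X\<^sup>T" .
    have XX: "X\<^sup>T * X = 1\<^sub>m (Suc n)"
      unfolding XT unfolding X_def using V
      by (simp add: block)
    let ?U = "W * X"
    have UT: "?U\<^sup>T = X\<^sup>T * W\<^sup>T" using W X by (rule transpose_mult)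
    have "?U\<^sup>T * ?U = X\<^sup>T * ((W\<^sup>T * W) * X)"
      unfolding UT using W X by (simp add: assoc)
    then have UU: "?U\<^sup>T * ?U = 1\<^sub>m (Suc n)" using WW XX X by simp
    have "A = (W * W\<^sup>T) * A * (W * W\<^sup>T)" using WW' A by simp
    also have "\<dots> = W * B * W\<^sup>T"
      unfolding B_def using W A by (simp add: assoc)
    also have "\<dots> = ?U * mat_diag (Suc n) d' * ?U\<^sup>T"
      unfolding BX UT using W X
      by (simp add: assoc mult_carrier_mat[of _ "Suc n" "Suc n" _ "Suc n"])
    finally show ?case using UU W X by (intro exI[of _ ?U] exI[of _ d']) auto
  qed
  with that show thesis by blast
qed

text \<open>Entrywise form of the diagonalization: rows and columns of the orthogonal matrix are
  both orthonormal, and the factored characteristic polynomial turns multiplicities into counts of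
  indices \<open>m\<close>.\<close>

theorem symmetric_mat_eigenbasis:
  fixes A :: "real mat"
  assumes A: "A \<in> carrier_mat n n" and sym: "A\<^sup>T = A"
  obtains u d where
    "\<forall>i<n. \<forall>j<n. (\<Sum>m<n. u i m * u j m) = (if i = j then 1 else 0)"
    "\<forall>i<n. \<forall>j<n. (\<Sum>m<n. u m i * u m j) = (if i = j then 1 else 0)"
    "\<forall>i<n. \<forall>j<n. A $$ (i, j) = (\<Sum>m<n. d m * (u i m * u j m))"
    "char_poly A = (\<Prod>m<n. [:- d m, 1:])"
proof -
  obtain U d where U: "U \<in> carrier_mat n n" and UU: "U\<^sup>T * U = 1\<^sub>m n"
    and AU: "A = U * mat_diag n d * U\<^sup>T"
    using symmetric_mat_diagonalization[OF A sym] by blast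
  have UU': "U * U\<^sup>T = 1\<^sub>m n" using mat_mult_left_right_inverse[OF _ U UU] U by simp
  have UD: "U * mat_diag n d = mat n n (\<lambda>(i, j). U $$ (i, j) * d j)"
    by (rule mat_diag_mult_right[OF U])
  have "similar_mat A (mat_diag n d)"
    using similar_mat_witI[OF UU' UU AU A mat_diag_dim U] U unfolding similar_mat_def by auto
  then have "char_poly A = char_poly (mat_diag n d)" by (rule char_poly_similar)
  also have "\<dots> = (\<Prod>a\<leftarrow>diag_mat (mat_diag n d). [:- a, 1:])"
    by (rule char_poly_upper_triangular[OF mat_diag_dim]) (auto simp: mat_diag_def)
  also have "diag_mat (mat_diag n d) = map d [0..<n]"
    by (auto simp: diag_mat_def mat_diag_def)
  also have "(\<Prod>a\<leftarrow>map d [0..<n]. [:- a, 1:]) = (\<Prod>m<n. [:- d m, 1:])"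
    by (simp add: prod.list_conv_set_nth atLeast0LessThan comp_def)
  finally have cp: "char_poly A = (\<Prod>m<n. [:- d m, 1:])" .
  show thesis
  proof (rule that[of "\<lambda>i m. U $$ (i, m)" d]; (intro allI impI)?)
    fix i j assume ij: "i < n" "j < n"
    show "(\<Sum>m<n. U $$ (i, m) * U $$ (j, m)) = (if i = j then 1 else 0)"
      using arg_cong[OF UU', of "\<lambda>M. M $$ (i, j)"] ij U
      by (simp add: scalar_prod_def atLeast0LessThan)
    show "(\<Sum>m<n. U $$ (m, i) * U $$ (m, j)) = (if i = j then 1 else 0)"
      using arg_cong[OF UU, of "\<lambda>M. M $$ (i, j)"] ij U
      by (simp add: scalar_prod_def atLeast0LessThan)
    show "A $$ (i, j) = (\<Sum>m<n. d m * (U $$ (i, m) * U $$ (j, m)))"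
      unfolding AU UD using ij U
      by (simp add: scalar_prod_def atLeast0LessThan ac_simps)
  qed (rule cp)
qed

section \<open>Two-eigenvalue matrices and tight frames\<close>

lemma spectrum_linear_factors:
  fixes A :: "'a :: field mat" and N :: nat
  assumes "A \<in> carrier_mat n n" and "char_poly A = (\<Prod>m<N. [:- d m, 1:])"
  shows "spectrum A = d ` {..<N}"
  unfolding spectrum_root_char_poly[OF assms(1)] assms(2)
  by (auto simp: poly_prod)

lemma order_linear_factors:
  fixes d :: "nat \<Rightarrow> 'a :: field"
  shows "order x (\<Prod>m<N. [:- d m, 1:]) = card {m. m < N \<and> d m = x}"
proof (induction N)
  case (Suc N)
  have "order x (\<Prod>m<Suc N. [:- d m, 1:]) = order x [:- d N, 1:] + card {m. m < N \<and> d m = x}"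
    unfolding prod.lessThan_Suc by (subst order_mult)
      (auto simp: Suc.IH prod_zero_iff simp del: mult_pCons_left mult_pCons_right)
  moreover have "order x [:- d N, 1:] = (if d N = x then 1 else 0)"
    using order_power_n_n[of x 1] by (auto simp: order_root intro!: order_0I)
  moreover have "{m. m < Suc N \<and> d m = x} = (if d N = x then {N} else {}) \<union> {m. m < N \<and> d m = x}"
    by (auto simp: less_Suc_eq)
  ultimately show ?case by simp
qed auto

lemma sym_matrices_num_eigenvalues_ge_2:
  assumes A: "A \<in> sym_matrices G"
    and e: "{u, v} \<in> edges G" "u \<noteq> v" "u \<in> verts G" "v \<in> verts G"
  shows "2 \<le> num_eigenvalues A"
proof (rule ccontr)
  assume less: "\<not> 2 \<le> num_eigenvalues A"
  define n where "n = card (verts G)"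
  obtain f where A': "A \<in> carrier_mat n n" "A\<^sup>T = A" and f: "bij_betw f {..<n} (verts G)"
    and Af: "\<And>i j. i < n \<Longrightarrow> j < n \<Longrightarrow> i \<noteq> j \<Longrightarrow> A $$ (i, j) \<noteq> 0 \<longleftrightarrow> {f i, f j} \<in> edges G"
    using A unfolding sym_matrices_def n_def by auto
  obtain i j where ij: "i < n" "j < n" "f i = u" "f j = v"
    using f e unfolding bij_betw_def by (metis imageE lessThan_iff)
  obtain w d where w: "\<forall>i<n. \<forall>j<n. (\<Sum>m<n. w i m * w j m) = (if i = j then 1 else 0)"
    and Aw: "\<forall>i<n. \<forall>j<n. A $$ (i, j) = (\<Sum>m<n. d m * (w i m * w j m))"
    and cp: "char_poly A = (\<Prod>m<n. [:- d m, 1:])"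
    by (rule symmetric_mat_eigenbasis[OF A']) blast
  note w = w[rule_format] and Aw = Aw[rule_format]
  have sp: "spectrum A = d ` {..<n}" by (rule spectrum_linear_factors[OF A'(1) cp])
  have "d m = d i" if "m < n" for m
  proof (rule ccontr)
    assume "d m \<noteq> d i"
    then have "card {d m, d i} = 2" by simp
    moreover have "card {d m, d i} \<le> card (spectrum A)"
      unfolding sp using that ij by (intro card_mono) auto
    ultimately show False using less unfolding num_eigenvalues_def by simp
  qed
  then have "A $$ (i, j) = d i * (\<Sum>m<n. w i m * w j m)"
    unfolding Aw[OF ij(1,2)] sum_distrib_left by (intro sum.cong) auto
  with w[OF ij(1,2)] ij e(2) have "A $$ (i, j) = 0" by auto
  with Af[OF ij(1,2)] ij e show False by auto
qed

text \<open>Here \<open>A - x I\<close> is \<open>y - x\<close> times the projection onto the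
  eigenspace of \<open>y\<close>. The vector of a vertex lists its entries in the \<open>k\<close>
  orthonormal eigenvectors for \<open>y\<close>, and inner products of such vectors are the entries
  of that projection.\<close>

lemma achieves_bipartition_representation:
  assumes "achieves_bipartition G k"
  obtains w :: "'a \<Rightarrow> nat \<Rightarrow> real" where
    "\<And>u v. u \<in> verts G \<Longrightarrow> v \<in> verts G \<Longrightarrow> u \<noteq> v \<Longrightarrow>
       (\<Sum>l<k. w u l * w v l) \<noteq> 0 \<longleftrightarrow> {u, v} \<in> edges G"
proof -
  define n where "n = card (verts G)"
  obtain A x y where A: "A \<in> sym_matrices G" and xy: "x \<noteq> y" "spectrum A = {x, y}"
    and k: "eigenvalue_multiplicity A y = k"
    using assms unfolding achieves_bipartition_def by auto
  obtain f where A': "A \<in> carrier_mat n n" "A\<^sup>T = A" and f: "bij_betw f {..<n} (verts G)"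
    and Af: "\<And>i j. i < n \<Longrightarrow> j < n \<Longrightarrow> i \<noteq> j \<Longrightarrow> A $$ (i, j) \<noteq> 0 \<longleftrightarrow> {f i, f j} \<in> edges G"
    using A unfolding sym_matrices_def n_def by auto
  obtain w d where w: "\<forall>i<n. \<forall>j<n. (\<Sum>m<n. w i m * w j m) = (if i = j then 1 else 0)"
    and Aw: "\<forall>i<n. \<forall>j<n. A $$ (i, j) = (\<Sum>m<n. d m * (w i m * w j m))"
    and cp: "char_poly A = (\<Prod>m<n. [:- d m, 1:])"
    by (rule symmetric_mat_eigenbasis[OF A']) blast
  note w = w[rule_format] and Aw = Aw[rule_format]
  have d: "d m = x \<or> d m = y" if "m < n" for m
    using spectrum_linear_factors[OF A'(1) cp] xy that by auto
  define Y where "Y = {m. m < n \<and> d m = y}"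
  have "card Y = k"
    using k unfolding eigenvalue_multiplicity_def cp order_linear_factors Y_def .
  then obtain h where h: "bij_betw h {..<k} Y"
    using ex_bij_betw_nat_finite[of Y] unfolding Y_def atLeast0LessThan by auto
  define g where "g = inv_into {..<n} f"
  have g: "g u < n" "f (g u) = u" if "u \<in> verts G" for u
    using f that unfolding g_def bij_betw_def
    by (metis inv_into_into lessThan_iff, metis f_inv_into_f)
  show thesis
  proof (rule that[of "\<lambda>u l. w (g u) (h l)"])
    fix u v assume uv: "u \<in> verts G" "v \<in> verts G" "u \<noteq> v"
    let ?i = "g u" and ?j = "g v"
    note i = g[OF uv(1)] and j = g[OF uv(2)]
    have ij: "?i \<noteq> ?j" using i j uv by metis
    \<comment> \<open>Off the diagonal, subtracting \<open>x\<close> times the identity changes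
      nothing, but it removes every eigenvector with eigenvalue \<open>x\<close> from the
      sum.\<close>
    have "A $$ (?i, ?j) = (\<Sum>m<n. d m * (w ?i m * w ?j m)) - x * (\<Sum>m<n. w ?i m * w ?j m)"
      using Aw[OF i(1) j(1)] w[OF i(1) j(1)] ij by simp
    also have "\<dots> = (\<Sum>m<n. (d m - x) * (w ?i m * w ?j m))"
      by (simp add: sum_distrib_left sum_subtractf algebra_simps)
    also have "\<dots> = (\<Sum>m\<in>Y. (y - x) * (w ?i m * w ?j m))"
      using d by (intro sum.mono_neutral_cong_right) (auto simp: Y_def)
    also have "\<dots> = (y - x) * (\<Sum>l<k. w ?i (h l) * w ?j (h l))"
      by (simp add: sum_distrib_left sum.reindex_bij_betw[OF h, of "\<lambda>m. (y - x) * (w ?i m * w ?j m)"])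
    finally show "(\<Sum>l<k. w ?i (h l) * w ?j (h l)) \<noteq> 0 \<longleftrightarrow> {u, v} \<in> edges G"
      using Af[OF i(1) j(1) ij] xy i j by simp
  qed
qed

text \<open>With the vectors as rows of a matrix \<open>M\<close>, the frame condition says that
  \<open>M\<^sup>T M\<close> is \<open>T\<close> times the identity. The Gram matrix
  \<open>A = M M\<^sup>T\<close> then satisfies \<open>A\<^sup>2 = T A\<close>, which leaves only
  the eigenvalues 0 and \<open>T\<close>; the trace fixes their multiplicities.\<close>

lemma tight_frame_achieves_bipartition:
  fixes w :: "'a \<Rightarrow> nat \<Rightarrow> real"
  assumes fin: "finite (verts G)" and k: "1 \<le> k" "k \<le> card (verts G) div 2" and T: "T \<noteq> 0"
    and frame: "\<And>i j. i < k \<Longrightarrow> j < k \<Longrightarrow>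
      (\<Sum>u\<in>verts G. w u i * w u j) = (if i = j then T else 0)"
    and adj: "\<And>u v. u \<in> verts G \<Longrightarrow> v \<in> verts G \<Longrightarrow> u \<noteq> v \<Longrightarrow>
      (\<Sum>l<k. w u l * w v l) \<noteq> 0 \<longleftrightarrow> {u, v} \<in> edges G"
  shows "achieves_bipartition G k"
proof -
  define n where "n = card (verts G)"
  obtain f where f: "bij_betw f {..<n} (verts G)"
    using ex_bij_betw_nat_finite[OF fin] unfolding n_def atLeast0LessThan by auto
  have frame': "(\<Sum>p<n. w (f p) i * w (f p) j) = (if i = j then T else 0)" if "i < k" "j < k" for i j
    using frame[OF that] sum.reindex_bij_betw[OF f, of "\<lambda>u. w u i * w u j"] by simp
  define A where "A = mat n n (\<lambda>(i, j). \<Sum>l<k. w (f i) l * w (f j) l)"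
  have A: "A \<in> carrier_mat n n" "A\<^sup>T = A"
    unfolding A_def by (auto intro!: eq_matI sum.cong)
  have AG: "A \<in> sym_matrices G"
  proof -
    have "A $$ (i, j) \<noteq> 0 \<longleftrightarrow> {f i, f j} \<in> edges G" if "i < n" "j < n" "i \<noteq> j" for i j
      using adj[of "f i" "f j"] f that unfolding A_def bij_betw_def inj_on_def by auto
    then show ?thesis using A f unfolding sym_matrices_def n_def by auto
  qed
  obtain z d where z: "\<forall>i<n. \<forall>j<n. (\<Sum>m<n. z i m * z j m) = (if i = j then 1 else 0)"
    and z': "\<forall>i<n. \<forall>j<n. (\<Sum>m<n. z m i * z m j) = (if i = j then 1 else 0)"
    and Az: "\<forall>i<n. \<forall>j<n. A $$ (i, j) = (\<Sum>m<n. d m * (z i m * z j m))"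
    and cp: "char_poly A = (\<Prod>m<n. [:- d m, 1:])"
    by (rule symmetric_mat_eigenbasis[OF A]) blast
  note z = z[rule_format] and z' = z'[rule_format] and Az = Az[rule_format]
  have d: "d m = 0 \<or> d m = T" if m: "m < n" for m
  proof -
    \<comment> \<open>\<open>y\<close> is the eigenvector pulled back to the
      \<open>k\<close>-dimensional space by the transposed frame matrix. Either \<open>y\<close> is
      nonzero and the frame condition gives \<open>d m = T\<close>, or the eigenvector is in the
      kernel of \<open>A\<close>.\<close>
    define y where "y l = (\<Sum>q<n. w (f q) l * z q m)" for l
    have ev: "d m * z p m = (\<Sum>l<k. w (f p) l * y l)" if p: "p < n" for p
    proof -
      have "(\<Sum>l<k. w (f p) l * y l) = (\<Sum>q<n. A $$ (p, q) * z q m)"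
        unfolding y_def using p
        by (simp add: A_def sum_distrib_left sum_distrib_right mult.assoc) (rule sum.swap)
      also have "\<dots> = (\<Sum>q<n. \<Sum>r<n. d r * z p r * (z q r * z q m))"
        using p by (simp add: Az sum_distrib_right mult.assoc)
      also have "\<dots> = (\<Sum>r<n. d r * z p r * (\<Sum>q<n. z q r * z q m))"
        by (subst sum.swap) (simp add: sum_distrib_left)
      also have "\<dots> = (\<Sum>r<n. if r = m then d r * z p r else 0)"
        using m by (intro sum.cong) (auto simp: z')
      also have "\<dots> = d m * z p m" using m by simp
      finally show ?thesis by simp
    qed
    have "d m * y l = T * y l" if l: "l < k" for l
    proof -
      have "d m * y l = (\<Sum>q<n. w (f q) l * (d m * z q m))"
        unfolding y_def by (simp add: sum_distrib_left algebra_simps)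
      also have "\<dots> = (\<Sum>q<n. \<Sum>l'<k. (w (f q) l * w (f q) l') * y l')"
        by (simp add: ev sum_distrib_left mult.assoc)
      also have "\<dots> = (\<Sum>l'<k. (\<Sum>q<n. w (f q) l * w (f q) l') * y l')"
        by (subst sum.swap) (simp add: sum_distrib_right)
      also have "\<dots> = (\<Sum>l'<k. if l = l' then T * y l' else 0)"
        using l by (intro sum.cong) (auto simp: frame')
      finally show ?thesis using l by simp
    qed
    then have "d m = T" if "l < k" "y l \<noteq> 0" for l using that by auto
    moreover have "d m = 0" if "\<forall>l<k. y l = 0"
    proof -
      have "\<forall>p<n. d m * z p m = 0" using ev that by simp
      then have "d m * (\<Sum>p<n. z p m * z p m) = 0"
        unfolding sum_distrib_left mult.assoc[symmetric] by (intro sum.neutral) auto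
      then show ?thesis using z'[OF m m] by simp
    qed
    ultimately show ?thesis by blast
  qed
  \<comment> \<open>The trace is computed twice: as the sum of the eigenvalues, and as the total
    squared norm of the frame, which is \<open>T\<close> for each of the \<open>k\<close>
    coordinates.\<close>
  have "(\<Sum>m<n. d m) = (\<Sum>m<n. d m * (\<Sum>i<n. z i m * z i m))" by (simp add: z')
  also have "\<dots> = (\<Sum>i<n. A $$ (i, i))"
    by (simp add: Az sum_distrib_left) (rule sum.swap)
  also have "\<dots> = (\<Sum>l<k. \<Sum>i<n. w (f i) l * w (f i) l)"
    by (simp add: A_def) (rule sum.swap)
  also have "\<dots> = real k * T" by (simp add: frame')
  finally have trace: "(\<Sum>m<n. d m) = real k * T" .
  have "(\<Sum>m<n. d m) = (\<Sum>m\<in>{m. m < n \<and> d m = T}. T)"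
    using d by (intro sum.mono_neutral_cong_right) auto
  with trace T have cT: "card {m. m < n \<and> d m = T} = k" by simp
  have "{m. m < n \<and> d m = 0} = {..<n} - {m. m < n \<and> d m = T}" using d T by auto
  then have c0: "card {m. m < n \<and> d m = 0} = n - k" using cT by (simp add: card_Diff_subset subset_eq)
  \<comment> \<open>With \<open>1 \<le> k < n\<close> both multiplicities are positive, so both 0
    and \<open>T\<close> really occur in the spectrum.\<close>
  have "k < n" using k unfolding n_def by linarith
  then have "{m. m < n \<and> d m = T} \<noteq> {}" "{m. m < n \<and> d m = 0} \<noteq> {}"
    using cT c0 k by (metis card.empty not_one_le_zero, metis card.empty zero_less_diff less_irrefl)
  then have "spectrum A = {0, T}"
    unfolding spectrum_linear_factors[OF A(1) cp] using d by auto
  moreover have "eigenvalue_multiplicity A 0 = n - k" "eigenvalue_multiplicity A T = k"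
    unfolding eigenvalue_multiplicity_def cp order_linear_factors by (rule c0, rule cT)
  ultimately show ?thesis
    using AG k T unfolding achieves_bipartition_def n_def by metis
qed

section \<open>Vertices and edges of the graph constructions\<close>

lemma complete_graph_edges [simp]:
  "{u, v} \<in> edges (complete_graph n) \<longleftrightarrow> u < n \<and> v < n \<and> u \<noteq> v"
  unfolding complete_graph_def by (auto simp: doubleton_eq_iff)

lemma complete_graph_verts [simp]: "verts (complete_graph n) = {..<n}"
  unfolding complete_graph_def by simp

lemma image_mem_image_image_iff:
  assumes "inj f"
  shows "f ` A \<in> (`) f ` \<A> \<longleftrightarrow> A \<in> \<A>"
  using assms by (metis (no_types, lifting) image_iff inj_image_eq_iff)

lemma disjoint_union_edges [simp]:
  "{Inl u, Inl u'} \<in> edges (disjoint_union G H) \<longleftrightarrow> {u, u'} \<in> edges G"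
  "{Inr v, Inr v'} \<in> edges (disjoint_union G H) \<longleftrightarrow> {v, v'} \<in> edges H"
  "{Inl u, Inr v} \<notin> edges (disjoint_union G H)"
  "{Inr v, Inl u} \<notin> edges (disjoint_union G H)"
proof -
  have Inl: "{Inl u, Inl u'} \<in> (`) Inl ` \<A> \<longleftrightarrow> {u, u'} \<in> \<A>" for u u' :: 'a and \<A>
    using image_mem_image_image_iff[of Inl "{u, u'}" \<A>] by simp
  have Inr: "{Inr v, Inr v'} \<in> (`) Inr ` \<A> \<longleftrightarrow> {v, v'} \<in> \<A>" for v v' :: 'b and \<A>
    using image_mem_image_image_iff[of Inr "{v, v'}" \<A>] by simp
  have Inl': "insert (Inl u) A \<notin> (`) Inr ` \<A>" for u :: 'a and A :: "('a + 'b) set" and \<A>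
    by (metis Inl_Inr_False imageE insertI1)
  have Inr': "insert (Inr v) A \<notin> (`) Inl ` \<A>" for v :: 'b and A :: "('a + 'b) set" and \<A>
    by (metis Inl_Inr_False imageE insertI1)
  note simps = disjoint_union_def Inl Inr Inl' Inr'
  show "{Inl u, Inl u'} \<in> edges (disjoint_union G H) \<longleftrightarrow> {u, u'} \<in> edges G"
    "{Inr v, Inr v'} \<in> edges (disjoint_union G H) \<longleftrightarrow> {v, v'} \<in> edges H"
    by (simp_all add: simps)
  show "{Inr v, Inl u} \<notin> edges (disjoint_union G H)"
    using Inl'[of u "{Inr v}" "edges H"] Inr'[of v "{Inl u}" "edges G"]
    by (simp add: disjoint_union_def insert_commute[of "Inl u" "Inr v"])
  then show "{Inl u, Inr v} \<notin> edges (disjoint_union G H)" by (simp add: insert_commute)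
qed

lemma disjoint_union_verts [simp]: "verts (disjoint_union G H) = verts G <+> verts H"
  unfolding disjoint_union_def by simp

lemma graph_join_edges [simp]:
  "{Inl u, Inl u'} \<in> edges (graph_join G H) \<longleftrightarrow> {u, u'} \<in> edges G"
  "{Inr v, Inr v'} \<in> edges (graph_join G H) \<longleftrightarrow> {v, v'} \<in> edges H"
  "{Inl u, Inr v} \<in> edges (graph_join G H) \<longleftrightarrow> u \<in> verts G \<and> v \<in> verts H"
  "{Inr v, Inl u} \<in> edges (graph_join G H) \<longleftrightarrow> u \<in> verts G \<and> v \<in> verts H"
  unfolding graph_join_def by (auto simp: doubleton_eq_iff)

lemma graph_join_verts [simp]: "verts (graph_join G H) = verts G <+> verts H"
  unfolding graph_join_def by simp

lemma family_join_edges: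
  "{(i, u), (j, v)} \<in> edges (family_join I F) \<longleftrightarrow> i \<in> I \<and> j \<in> I \<and>
     (if i = j then {u, v} \<in> edges (F i) else u \<in> verts (F i) \<and> v \<in> verts (F j))"
proof (cases "i = j")
  case True
  have "{(i, u), (i, v)} \<in> (`) (Pair k) ` edges (F k) \<longleftrightarrow> k = i \<and> {u, v} \<in> edges (F i)" for k
  proof (cases "k = i")
    case True
    then show ?thesis
      using image_mem_image_image_iff[of "Pair i" "{u, v}" "edges (F i)"] by (simp add: inj_on_def)
  next
    case False
    then have "{(i, u), (i, v)} \<noteq> Pair k ` e" for e by (metis Pair_inject imageE insertI1)
    then show ?thesis using False by auto
  qed
  then show ?thesis
    using True unfolding family_join_def by (auto simp: doubleton_eq_iff)
next
  case False
  have "{(i, u), (j, v)} \<notin> (`) (Pair k) ` edges (F k)" for k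
  proof -
    have "{(i, u), (j, v)} \<noteq> Pair k ` e" for e
      using False by (metis Pair_inject imageE insertI1 insertI2)
    then show ?thesis by auto
  qed
  then show ?thesis
    using False unfolding family_join_def by (auto simp: doubleton_eq_iff)
qed

lemma family_join_verts [simp]: "verts (family_join I F) = Sigma I (\<lambda>i. verts (F i))"
  unfolding family_join_def by simp

lemma two_cliques_verts [simp]: "verts (two_cliques a b) = {..<a} <+> {..<b}"
  unfolding two_cliques_def by simp

lemma two_cliques_edges:
  assumes "u \<in> {..<a} <+> {..<b}" "v \<in> {..<a} <+> {..<b}" "u \<noteq> v"
  shows "{u, v} \<in> edges (two_cliques a b) \<longleftrightarrow> isl u = isl v"
  using assms unfolding two_cliques_def by auto

section \<open>Uniform labelling of the dotted join\<close>

text \<open>The first two groups sit in nested sums and the others in an indexed family. Pairing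
  every vertex with its group number puts all groups on the same footing.\<close>

fun join_label :: "('s + 's) + (nat \<times> 's) \<Rightarrow> nat \<times> 's" where
  "join_label (Inl (Inl s)) = (1, s)"
| "join_label (Inl (Inr s)) = (2, s)"
| "join_label (Inr v) = v"

lemma bij_betw_join_label:
  assumes "2 \<le> l"
  shows "bij_betw join_label ((S 1 <+> S 2) <+> Sigma {3..l} S) (Sigma {1..l} S)"
proof -
  have "inj_on join_label ((S 1 <+> S 2) <+> Sigma {3..l} S)"
    by (rule inj_onI) (elim PlusE SigmaE; hypsubst; simp)
  moreover have "join_label ` ((S 1 <+> S 2) <+> Sigma {3..l} S)
      = Pair 1 ` S 1 \<union> Pair 2 ` S 2 \<union> Sigma {3..l} S"
    unfolding Plus_def by (simp add: image_Un image_image)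
  moreover have "{1..l} = {1, 2} \<union> {3..l}" using assms by auto
  then have "Pair 1 ` S 1 \<union> Pair 2 ` S 2 \<union> Sigma {3..l} S = Sigma {1..l} S" by auto
  ultimately show ?thesis unfolding bij_betw_def by simp
qed

text \<open>Everything later refers to a single adjacency rule on labels: vertices of one group are
  adjacent iff they lie in the same clique, vertices of different groups always, apart from the two
  removed pairs.\<close>

lemma dotted_join_labelling:
  fixes a b :: "nat \<Rightarrow> nat"
  assumes l: "2 \<le> l" and H: "H \<in> dotted_joins (a 1) (b 1) (a 2) (b 2)"
    and iso: "isomorphic G (graph_join H (family_join {3..l} (\<lambda>i. two_cliques (a i) (b i))))"
  obtains h p p' q q' where
    "bij_betw h (verts G) (SIGMA i:{1..l}. {..<a i} <+> {..<b i})"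
    "p < a 1" "p' < a 1" "p \<noteq> p'" "q < a 2" "q' < a 2" "q \<noteq> q'"
    "\<And>u v. u \<in> verts G \<Longrightarrow> v \<in> verts G \<Longrightarrow> u \<noteq> v \<Longrightarrow>
       {u, v} \<in> edges G \<longleftrightarrow>
         (fst (h u) = fst (h v) \<longrightarrow> isl (snd (h u)) = isl (snd (h v))) \<and>
         {h u, h v} \<notin> {{(1, Inl p), (2, Inl q)}, {(1, Inl p'), (2, Inl q')}}"
proof -
  define J where "J = graph_join (two_cliques (a 1) (b 1)) (two_cliques (a 2) (b 2))"
  define K where "K = graph_join H (family_join {3..l} (\<lambda>i. two_cliques (a i) (b i)))"
  define S where "S i = {..<a i} <+> {..<b i}" for i
  \<comment> \<open>Disjointness of the removed edges turns into distinct endpoints in each of the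
    two cliques.\<close>
  obtain p q p' q' where pq: "p < a 1" "p' < a 1" "p \<noteq> p'" "q < a 2" "q' < a 2" "q \<noteq> q'"
    and HJ: "H = delete_edges J {{Inl (Inl p), Inr (Inl q)}, {Inl (Inl p'), Inr (Inl q')}}"
    using H unfolding dotted_joins_def clique_cross_edges_def J_def by auto
  obtain f where f: "bij_betw f (verts G) (verts K)"
    and fG: "\<And>u v. u \<in> verts G \<Longrightarrow> v \<in> verts G \<Longrightarrow> {u, v} \<in> edges G \<longleftrightarrow> {f u, f v} \<in> edges K"
    using iso unfolding isomorphic_def K_def by auto
  have vK: "verts K = (S 1 <+> S 2) <+> Sigma {3..l} S"
    unfolding K_def HJ J_def S_def by (simp add: delete_edges_def)
  have HE: "{u, v} \<in> edges H \<longleftrightarrow> {u, v} \<in> edges J \<and>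
      {u, v} \<notin> {{Inl (Inl p), Inr (Inl q)}, {Inl (Inl p'), Inr (Inl q')}}" for u v
    unfolding HJ by (simp add: delete_edges_def)
  have vH: "verts H = S 1 <+> S 2" unfolding HJ J_def S_def by (simp add: delete_edges_def)
  have KE1: "{Inl (Inl s), Inl (Inl t)} \<in> edges K \<longleftrightarrow> isl s = isl t" if "s \<in> S 1" "t \<in> S 1" "s \<noteq> t" for s t
    using that two_cliques_edges[of s "a 1" "b 1" t] by (simp add: K_def HE J_def S_def doubleton_eq_iff)
  have KE2: "{Inl (Inr s), Inl (Inr t)} \<in> edges K \<longleftrightarrow> isl s = isl t" if "s \<in> S 2" "t \<in> S 2" "s \<noteq> t" for s t
    using that two_cliques_edges[of s "a 2" "b 2" t] by (simp add: K_def HE J_def S_def doubleton_eq_iff)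
  have KE12: "{Inl (Inl s), Inl (Inr t)} \<in> edges K \<longleftrightarrow> (s, t) \<noteq> (Inl p, Inl q) \<and> (s, t) \<noteq> (Inl p', Inl q')"
    if "s \<in> S 1" "t \<in> S 2" for s t
    using that by (simp add: K_def HE J_def S_def doubleton_eq_iff)
  have KE0: "{Inl (Inl s), Inr (i, t)} \<in> edges K" if "s \<in> S 1" "3 \<le> i" "i \<le> l" "t \<in> S i" for s i t
    using that by (auto simp: K_def vH S_def)
  have KE0': "{Inl (Inr s), Inr (i, t)} \<in> edges K" if "s \<in> S 2" "3 \<le> i" "i \<le> l" "t \<in> S i" for s i t
    using that by (auto simp: K_def vH S_def)
  have KE3: "{Inr (i, s), Inr (j, t)} \<in> edges K \<longleftrightarrow> (i = j \<longrightarrow> isl s = isl t)"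
    if "(i, s) \<in> Sigma {3..l} S" "(j, t) \<in> Sigma {3..l} S" "(i, s) \<noteq> (j, t)" for i j s t
    using that two_cliques_edges[of s "a i" "b i" t]
    by (cases "i = j") (simp_all add: K_def family_join_edges S_def)
  have KE: "{u, v} \<in> edges K \<longleftrightarrow>
      (fst (join_label u) = fst (join_label v) \<longrightarrow> isl (snd (join_label u)) = isl (snd (join_label v))) \<and>
      {join_label u, join_label v} \<notin> {{(1, Inl p), (2, Inl q)}, {(1, Inl p'), (2, Inl q')}}"
    if "u \<in> verts K" "v \<in> verts K" "u \<noteq> v" for u v
    using that unfolding vK
    by (elim PlusE SigmaE; hypsubst)
      (auto simp: KE1 KE2 KE12 KE0 KE0' KE3 insert_commute[of "Inr _" "Inl _"]
        insert_commute[of "Inl (Inr _)" "Inl (Inl _)"] doubleton_eq_iff)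
  note jl = bij_betw_join_label[OF l, of S]
  show thesis
  proof (rule that[of "join_label \<circ> f", OF _ pq])
    show "bij_betw (join_label \<circ> f) (verts G) (SIGMA i:{1..l}. {..<a i} <+> {..<b i})"
      using bij_betw_trans[OF f jl[folded vK]] unfolding S_def .
    fix u v assume uv: "u \<in> verts G" "v \<in> verts G" "u \<noteq> v"
    then have "f u \<in> verts K" "f v \<in> verts K" "f u \<noteq> f v"
      using f unfolding bij_betw_def inj_on_def by auto
    from KE[OF this] show "{u, v} \<in> edges G \<longleftrightarrow>
         (fst ((join_label \<circ> f) u) = fst ((join_label \<circ> f) v) \<longrightarrow>
           isl (snd ((join_label \<circ> f) u)) = isl (snd ((join_label \<circ> f) v))) \<and>
         {(join_label \<circ> f) u, (join_label \<circ> f) v} \<notin>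
           {{(1, Inl p), (2, Inl q)}, {(1, Inl p'), (2, Inl q')}}"
      using fG[OF uv(1,2)] by simp
  qed
qed

section \<open>Tight frame in dimension 3\<close>

text \<open>The two conditions amount to \<open>(r + s)\<^sup>2 = R + 2\<close> and
  \<open>(r - s)\<^sup>2 = R - 2\<close>, solvable over the reals exactly from \<open>R = 2\<close>
  on.\<close>

lemma reciprocal_pair_with_square_sum:
  fixes R :: real
  assumes "2 \<le> R"
  obtains r s where "r * s = 1" "r\<^sup>2 + s\<^sup>2 = R"
proof
  let ?x = "sqrt (R + 2)" and ?y = "sqrt (R - 2)"
  have sq: "?x\<^sup>2 = R + 2" "?y\<^sup>2 = R - 2" using assms by auto
  have "(?x + ?y) / 2 * ((?x - ?y) / 2) = (?x\<^sup>2 - ?y\<^sup>2) / 4"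
    by (simp add: power2_eq_square algebra_simps)
  then show "(?x + ?y) / 2 * ((?x - ?y) / 2) = 1" unfolding sq by simp
  have "((?x + ?y) / 2)\<^sup>2 + ((?x - ?y) / 2)\<^sup>2 = (?x\<^sup>2 + ?y\<^sup>2) / 2"
    by (simp add: power2_eq_square field_simps)
  then show "((?x + ?y) / 2)\<^sup>2 + ((?x - ?y) / 2)\<^sup>2 = R" unfolding sq by simp
qed

text \<open>This is the height profile of a lifted clique. Its zero sum makes the third coordinate
  orthogonal to the planar ones, and its square sum is what the clique contributes to the third
  direction.\<close>

lemma sum_indicator_difference:
  fixes P Q n :: nat
  assumes "P < n" "Q < n" "P \<noteq> Q"
  shows "(\<Sum>x<n. of_bool (x = P) - of_bool (x = Q) :: real) = 0"
    and "(\<Sum>x<n. (of_bool (x = P) - of_bool (x = Q) :: real)\<^sup>2) = 2"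
proof -
  have "(\<Sum>x<n. of_bool (x = P) - of_bool (x = Q) :: real)
      = (\<Sum>x<n. if x = P then 1 else 0) - (\<Sum>x<n. if x = Q then 1 else 0)"
    by (simp add: of_bool_def sum_subtractf)
  then show "(\<Sum>x<n. of_bool (x = P) - of_bool (x = Q) :: real) = 0" using assms by simp
  have "(\<Sum>x<n. (of_bool (x = P) - of_bool (x = Q) :: real)\<^sup>2)
      = (\<Sum>x<n. (if x = P then 1 else 0) + (if x = Q then 1 else 0))"
    using assms by (intro sum.cong) auto
  then show "(\<Sum>x<n. (of_bool (x = P) - of_bool (x = Q) :: real)\<^sup>2) = 2"
    using assms by (simp add: sum.distrib)
qed

text \<open>
  With \<open>\<tau>\<close> the slope of the \<open>i\<close>-th group, its two cliques are represented along the orthogonal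
  directions \<open>(1, \<tau>, 0)\<close> and \<open>(-\<tau>, 1, 0)\<close>. Only the four endpoints of the removed edges leave
  this plane; the heights \<open>r\<close>, \<open>-r\<close>, \<open>-s\<close>, \<open>s\<close> with \<open>r s = 1\<close> cancel the planar inner product
  \<open>1\<close> of the first two groups exactly on the removed edges.
\<close>

lemma dotted_join_tight_frame:
  fixes a b :: "nat \<Rightarrow> nat" and l p p' q q' :: nat
  assumes l: "2 \<le> l" and a: "\<And>i. i \<in> {1..l} \<Longrightarrow> 2 \<le> a i" and b: "\<And>i. i \<in> {1..l} \<Longrightarrow> 1 \<le> b i"
    and p: "p < a 1" "p' < a 1" "p \<noteq> p'" and q: "q < a 2" "q' < a 2" "q \<noteq> q'"
  defines "V \<equiv> SIGMA i:{1..l}. {..<a i} <+> {..<b i}"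
  obtains w :: "nat \<times> (nat + nat) \<Rightarrow> nat \<Rightarrow> real" and T where
    "T \<noteq> 0"
    "\<And>j k. j < 3 \<Longrightarrow> k < 3 \<Longrightarrow> (\<Sum>u\<in>V. w u j * w u k) = (if j = k then T else 0)"
    "\<And>u v. u \<in> V \<Longrightarrow> v \<in> V \<Longrightarrow> u \<noteq> v \<Longrightarrow>
       (\<Sum>k<3. w u k * w v k) \<noteq> 0 \<longleftrightarrow>
         (fst u = fst v \<longrightarrow> isl (snd u) = isl (snd v)) \<and>
         {u, v} \<notin> {{(1, Inl p), (2, Inl q)}, {(1, Inl p'), (2, Inl q')}}"
proof -
  define \<tau> where "\<tau> i = real i - 1" for i :: nat
  \<comment> \<open>The squared norm that the groups together give to either planar coordinate.
    Groups 1 and 2 have slopes 0 and 1, hence weights 1 and 2, so they alone contribute at least 2 +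
    4.\<close>
  define T where "T = (\<Sum>i\<in>{1..l}. real (a i) * (1 + (\<tau> i)\<^sup>2))"
  have "(\<Sum>i\<in>{1, 2}. real (a i) * (1 + (\<tau> i)\<^sup>2)) \<le> T"
    unfolding T_def using l by (intro sum_mono2) auto
  then have "real (a 1) + 2 * real (a 2) \<le> T" by (simp add: \<tau>_def)
  moreover have "2 \<le> real (a 1)" "2 \<le> real (a 2)" using a[of 1] a[of 2] l by auto
  ultimately have T6: "6 \<le> T" by linarith
  obtain r s where rs: "r * s = 1" "r\<^sup>2 + s\<^sup>2 = T / 2"
    using reciprocal_pair_with_square_sum[of "T / 2"] T6 by auto
  have rs1: "r\<^sup>2 * s\<^sup>2 = 1" using rs(1) by (metis power_mult_distrib power_one)
  \<comment> \<open>The lifted pair in the first clique has inner product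
    \<open>1 - r\<^sup>2\<close>, the one in the second \<open>2 - s\<^sup>2\<close>. Together with
    \<open>r s = 1\<close>, vanishing would mean \<open>T = 4\<close> or \<open>T = 5\<close>
    respectively.\<close>
  have r1: "r\<^sup>2 \<noteq> 1" using rs1 rs(2) T6 by auto
  have s2: "s\<^sup>2 \<noteq> 2" using rs1 rs(2) T6 by auto
  define c where "c i = (if i = 1 then r else if i = 2 then - s else 0)" for i :: nat
  \<comment> \<open>From group 3 on the height \<open>c i\<close> is 0; the values 0 and 1 are
    placeholders that lie in the clique because \<open>a i \<ge> 2\<close>, so the sums of
    \<open>\<delta>\<close> need no case distinction.\<close>
  define P where "P i = (if i = 1 then p else if i = 2 then q else 0)" for i :: nat
  define Q where "Q i = (if i = 1 then p' else if i = 2 then q' else 1)" for i :: nat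
  define \<delta> :: "nat \<Rightarrow> nat \<Rightarrow> real" where "\<delta> i x = of_bool (x = P i) - of_bool (x = Q i)" for i x
  \<comment> \<open>This scaling gives the second clique the same total weight as the first, so that
    two orthogonal directions yield a scalar Gram matrix in the plane for each group.\<close>
  define \<kappa> where "\<kappa> i = sqrt (real (a i) / real (b i))" for i
  define wA where "wA i x k = (if k = 0 then 1 else if k = 1 then \<tau> i else c i * \<delta> i x)" for i x k :: nat
  define wB where "wB i k = \<kappa> i * (if k = 0 then - \<tau> i else if k = 1 then 1 else 0)" for i k :: nat
  define w where "w u k = (case snd u of Inl x \<Rightarrow> wA (fst u) x k | Inr y \<Rightarrow> wB (fst u) k)"
    for u :: "nat \<times> (nat + nat)" and k
  have PQ: "P i < a i" "Q i < a i" "P i \<noteq> Q i" if "i \<in> {1..l}" for i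
    using a[OF that] p q by (auto simp: P_def Q_def)
  have \<delta>0: "(\<Sum>x<a i. \<delta> i x) = 0" and \<delta>2: "(\<Sum>x<a i. (\<delta> i x)\<^sup>2) = 2" if "i \<in> {1..l}" for i
    unfolding \<delta>_def using sum_indicator_difference[OF PQ[OF that]] by simp_all
  have \<kappa>2: "real (b i) * (\<kappa> i)\<^sup>2 = real (a i)" if "i \<in> {1..l}" for i
    using b[OF that] by (simp add: \<kappa>_def)
  have \<kappa>0: "\<kappa> i > 0" if "i \<in> {1..l}" for i
    using a[OF that] b[OF that] by (simp add: \<kappa>_def)
  \<comment> \<open>\<open>g i\<close> is the contribution of group \<open>i\<close> to the frame
    sums; the vectors of its second clique are all equal, hence the factor
    \<open>b i\<close>.\<close>
  define g where "g i j k = (\<Sum>x<a i. wA i x j * wA i x k) + real (b i) * (wB i j * wB i k)" for i j k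
  have sumV: "(\<Sum>u\<in>V. w u j * w u k) = (\<Sum>i\<in>{1..l}. g i j k)" for j k
    unfolding V_def g_def
    by (subst sum.Sigma[symmetric, where g = "\<lambda>i s. w (i, s) j * w (i, s) k", simplified case_prod_unfold prod.collapse])
      (auto simp: sum.Plus w_def)
  have g00: "g i 0 0 = real (a i) * (1 + (\<tau> i)\<^sup>2)" and g11: "g i 1 1 = real (a i) * (1 + (\<tau> i)\<^sup>2)"
    and g01: "g i 0 1 = 0" and g02: "g i 0 2 = 0" and g12: "g i 1 2 = 0" and g22: "g i 2 2 = 2 * (c i)\<^sup>2"
    if i: "i \<in> {1..l}" for i
  proof -
    show "g i 0 0 = real (a i) * (1 + (\<tau> i)\<^sup>2)" "g i 1 1 = real (a i) * (1 + (\<tau> i)\<^sup>2)" "g i 0 1 = 0"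
      using \<kappa>2[OF i] by (simp_all add: g_def wA_def wB_def power2_eq_square algebra_simps)
    show "g i 0 2 = 0" "g i 1 2 = 0" "g i 2 2 = 2 * (c i)\<^sup>2"
      using \<delta>0[OF i] \<delta>2[OF i]
      by (simp_all add: g_def wA_def wB_def sum_distrib_left[symmetric] power2_eq_square
          mult.assoc mult.left_commute[of "\<delta> _ _" "c _"])
  qed
  have gsym: "g i j k = g i k j" for i j k by (simp add: g_def mult.commute)
  \<comment> \<open>Only the first two groups leave the plane, so the third direction receives
    \<open>2 * (r\<^sup>2 + s\<^sup>2)\<close>, which the choice of \<open>r\<close> and
    \<open>s\<close> makes equal to \<open>T\<close>.\<close>
  have "(\<Sum>i\<in>{1..l}. 2 * (c i)\<^sup>2) = (\<Sum>i\<in>{1, 2}. 2 * (c i)\<^sup>2)"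
    using l by (intro sum.mono_neutral_right) (auto simp: c_def)
  also have "\<dots> = T" using rs(2) by (simp add: c_def)
  finally have c2: "(\<Sum>i\<in>{1..l}. 2 * (c i)\<^sup>2) = T" .
  have frame: "(\<Sum>u\<in>V. w u j * w u k) = (if j = k then T else 0)" if "j < 3" "k < 3" for j k
  proof -
    have "j = 0 \<or> j = 1 \<or> j = 2" "k = 0 \<or> k = 1 \<or> k = 2" using that by auto
    then show ?thesis
      unfolding sumV using gsym[of _ 1 0] gsym[of _ 2 0] gsym[of _ 2 1]
      by (elim disjE; simp add: g00 g11 g01 g02 g12 g22 c2 T_def flip: One_nat_def)
  qed
  have sum3: "(\<Sum>k<3. f k) = f 0 + f 1 + f 2" for f :: "nat \<Rightarrow> real"
    by (simp add: eval_nat_numeral)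
  have AA: "(\<Sum>k<3. w (i, Inl x) k * w (j, Inl y) k) = 1 + \<tau> i * \<tau> j + c i * \<delta> i x * (c j * \<delta> j y)" for i j x y
    by (simp add: sum3 w_def wA_def)
  \<comment> \<open>The heights meet a zero coordinate here, so orthogonality depends only on
    whether the slopes agree, that is, on \<open>i = j\<close>.\<close>
  have AB: "(\<Sum>k<3. w (i, Inl x) k * w (j, Inr y) k) = \<kappa> j * (\<tau> i - \<tau> j)" for i j x y
    by (simp add: sum3 w_def wA_def wB_def algebra_simps)
  have BB: "(\<Sum>k<3. w (i, Inr x) k * w (j, Inr y) k) = \<kappa> i * \<kappa> j * (1 + \<tau> i * \<tau> j)" for i j x y
    by (simp add: sum3 w_def wB_def algebra_simps)
  \<comment> \<open>Nonnegative slopes keep the planar product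
    \<open>1 + \<tau> i * \<tau> j\<close> at least 1, so only a product of heights can cancel
    it.\<close>
  have \<tau>: "0 \<le> \<tau> i * \<tau> j" if "i \<in> {1..l}" "j \<in> {1..l}" for i j
    using that by (simp add: \<tau>_def)
  have AA0: "1 + \<tau> i * \<tau> j + c i * \<delta> i x * (c j * \<delta> j y) \<noteq> 0 \<longleftrightarrow>
      {(i, Inl x), (j, Inl y)} \<notin> {{(1, Inl p), (2, Inl q)}, {(1, Inl p'), (2, Inl q' :: nat + nat)}}"
    if "i \<in> {1..l}" "j \<in> {1..l}" "(i, x) \<noteq> (j, y)" for i j x y
  proof -
    have pos: "1 + \<tau> i * \<tau> j \<noteq> 0" using \<tau>[OF that(1,2)] by linarith
    have "i = 1 \<or> i = 2 \<or> 3 \<le> i" "j = 1 \<or> j = 2 \<or> 3 \<le> j" using that by auto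
    moreover have "3 \<le> k \<Longrightarrow> c k = 0" for k by (simp add: c_def)
    ultimately consider "i = 1" "j = 1" | "i = 2" "j = 2" | "i = 1" "j = 2" | "i = 2" "j = 1" | "c i = 0 \<or> c j = 0" "3 \<le> i \<or> 3 \<le> j"
      by blast
    then show ?thesis
    proof cases
      case 1
      then show ?thesis using that p r1
        by (auto simp: \<tau>_def c_def \<delta>_def P_def Q_def doubleton_eq_iff power2_eq_square)
    next
      case 2
      then show ?thesis using that q s2
        by (auto simp: \<tau>_def c_def \<delta>_def P_def Q_def doubleton_eq_iff power2_eq_square)
    next
      case 3
      then show ?thesis using that p q rs(1)
        by (auto simp: \<tau>_def c_def \<delta>_def P_def Q_def doubleton_eq_iff)
    next
      case 4
      then show ?thesis using that p q rs(1)
        by (auto simp: \<tau>_def c_def \<delta>_def P_def Q_def doubleton_eq_iff mult.commute)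
    next
      case 5
      from 5(1) have "c i * \<delta> i x * (c j * \<delta> j y) = 0" by (elim disjE) simp_all
      moreover from 5(2) have "{(i, Inl x), (j, Inl y)} \<notin>
          {{(1, Inl p), (2, Inl q)}, {(1, Inl p'), (2, Inl q' :: nat + nat)}}"
        by (auto simp: doubleton_eq_iff)
      ultimately show ?thesis using pos by (metis add.right_neutral)
    qed
  qed
  show thesis
  proof (rule that[of T w, OF _ frame])
    show "T \<noteq> 0" using T6 by simp
    fix u v assume uv: "u \<in> V" "v \<in> V" "u \<noteq> v"
    obtain i x j y where u: "u = (i, x)" and v: "v = (j, y)" by (cases u; cases v)
    have ij: "i \<in> {1..l}" "j \<in> {1..l}" using uv unfolding u v V_def by auto
    have \<tau>ij: "\<tau> i - \<tau> j \<noteq> 0 \<longleftrightarrow> i \<noteq> j" "1 + \<tau> i * \<tau> j \<noteq> 0"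
      using \<tau>[OF ij] by (auto simp: \<tau>_def)
    show "(\<Sum>k<3. w u k * w v k) \<noteq> 0 \<longleftrightarrow>
         (fst u = fst v \<longrightarrow> isl (snd u) = isl (snd v)) \<and>
         {u, v} \<notin> {{(1, Inl p), (2, Inl q)}, {(1, Inl p'), (2, Inl q')}}"
    proof (cases x; cases y)
      fix x' y' assume xy: "x = Inl x'" "y = Inl y'"
      then have "(i, x') \<noteq> (j, y')" using uv u v by auto
      from AA0[OF ij this] show ?thesis unfolding u v xy AA by simp
    next
      fix x' y' assume xy: "x = Inl x'" "y = Inr y'"
      then show ?thesis unfolding u v xy AB using \<tau>ij \<kappa>0[OF ij(2)] by (auto simp: doubleton_eq_iff)
    next
      fix x' y' assume xy: "x = Inr x'" "y = Inl y'"
      have "(\<Sum>k<3. w (i, Inr x') k * w (j, Inl y') k) = \<kappa> i * (\<tau> j - \<tau> i)"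
        using AB[of j y' i x'] by (simp add: mult.commute)
      then show ?thesis unfolding u v xy using \<tau>ij \<kappa>0[OF ij(1)] by (auto simp: doubleton_eq_iff)
    next
      fix x' y' assume xy: "x = Inr x'" "y = Inr y'"
      then show ?thesis unfolding u v xy BB using \<tau>ij \<kappa>0[OF ij(1)] \<kappa>0[OF ij(2)]
        by (auto simp: doubleton_eq_iff)
    qed
  qed
qed

text \<open>In the plane, \<open>x \<bottom> z\<close> and \<open>x \<bottom> y\<close> make \<open>y\<close> and \<open>z\<close> parallel, so \<open>x' \<bottom> z\<close> forces \<open>x' \<bottom> y\<close>.\<close>

lemma orthogonality_rank_le_2:
  fixes x x' y z :: "nat \<Rightarrow> real"
  assumes k: "k \<le> 2"
    and orth: "(\<Sum>i<k. x i * z i) = 0" "(\<Sum>i<k. x' i * z i) = 0" "(\<Sum>i<k. x i * y i) = 0"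
    and nonzero: "(\<Sum>i<k. x i * x' i) \<noteq> 0" "(\<Sum>i<k. z i * y i) \<noteq> 0"
  shows "(\<Sum>i<k. x' i * y i) = 0"
proof -
  have "k = 0 \<or> k = 1 \<or> k = 2" using k by auto
  then consider "k = 0" | "k = 1" | "k = 2" by blast
  then show ?thesis
  proof cases
    case 3
    define D where "D = x' 0 * y 0 + x' 1 * y 1"
    have o: "x 0 * z 0 + x 1 * z 1 = 0" "x' 0 * z 0 + x' 1 * z 1 = 0" "x 0 * y 0 + x 1 * y 1 = 0"
      and n: "x 0 * x' 0 + x 1 * x' 1 \<noteq> 0" "z 0 * y 0 + z 1 * y 1 \<noteq> 0"
      using orth nonzero 3 by (simp_all add: eval_nat_numeral)
    \<comment> \<open>\<open>E\<close> is the planar cross product of \<open>z\<close> and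
      \<open>y\<close>. It vanishes since both are orthogonal to \<open>x\<close>, and
      \<open>x\<close> is nonzero because of its product with \<open>x'\<close>.\<close>
    define E where "E = z 0 * y 1 - z 1 * y 0"
    have "x 0 * E = y 1 * (x 0 * z 0 + x 1 * z 1) - z 1 * (x 0 * y 0 + x 1 * y 1)"
      "x 1 * E = z 0 * (x 0 * y 0 + x 1 * y 1) - y 0 * (x 0 * z 0 + x 1 * z 1)"
      unfolding E_def by (simp_all add: algebra_simps)
    then have "E = 0" using o n by auto
    moreover have "z 0 * D = y 0 * (x' 0 * z 0 + x' 1 * z 1) + x' 1 * E"
      "z 1 * D = y 1 * (x' 0 * z 0 + x' 1 * z 1) - x' 0 * E"
      unfolding D_def E_def by (simp_all add: algebra_simps)
    ultimately have "z 0 * D = 0" "z 1 * D = 0" using o by simp_all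
    \<comment> \<open>The nonzero product of \<open>z\<close> and \<open>y\<close> guarantees a
      nonzero coordinate of \<open>z\<close> to cancel.\<close>
    then have "D = 0" using n by auto
    then show ?thesis using 3 by (simp add: D_def eval_nat_numeral)
  qed (use orth nonzero in auto)
qed

section \<open>The values of q and MB\<close>

theorem lemma4p4:
  fixes l :: nat and a b :: "nat \<Rightarrow> nat" and G :: "'v graph"
    and H :: "((nat + nat) + (nat + nat)) graph"
  assumes "l \<ge> 2"
    and "\<And>i. i \<in> {1..l} \<Longrightarrow> a i \<ge> 2"
    and "\<And>i. i \<in> {1..l} \<Longrightarrow> b i \<ge> 1"
    and "b 2 \<ge> 2"
    and "simple_graph G"
    and "H \<in> dotted_joins (a 1) (b 1) (a 2) (b 2)"
    and "isomorphic G (graph_join H (family_join {3..l} (\<lambda>i. two_cliques (a i) (b i))))"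
  shows "min_num_eigenvalues G = 2 \<and> MB G = 3"
proof -
  note a = assms(2) and b = assms(3)
  define V where "V = (SIGMA i:{1..l}. {..<a i} <+> {..<b i})"
  obtain h p p' q q' where h: "bij_betw h (verts G) V"
    and pq: "p < a 1" "p' < a 1" "p \<noteq> p'" "q < a 2" "q' < a 2" "q \<noteq> q'"
    and hG: "\<And>u v. u \<in> verts G \<Longrightarrow> v \<in> verts G \<Longrightarrow> u \<noteq> v \<Longrightarrow>
       {u, v} \<in> edges G \<longleftrightarrow>
         (fst (h u) = fst (h v) \<longrightarrow> isl (snd (h u)) = isl (snd (h v))) \<and>
         {h u, h v} \<notin> {{(1, Inl p), (2, Inl q)}, {(1, Inl p'), (2, Inl q')}}"
    unfolding V_def by (rule dotted_join_labelling[OF assms(1,6,7)]) blast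
  have fin: "finite (verts G)" using assms(5) unfolding simple_graph_def by simp
  have a12: "2 \<le> a 1" "2 \<le> a 2" and b1: "1 \<le> b 1" using a[of 1] a[of 2] b[of 1] assms(1) by auto
  have "card V = (\<Sum>i\<in>{1..l}. a i + b i)"
    unfolding V_def by (simp add: card_Plus)
  moreover have "(\<Sum>i\<in>{1, 2}. a i + b i) \<le> (\<Sum>i\<in>{1..l}. a i + b i)"
    using assms(1) by (intro sum_mono2) auto
  \<comment> \<open>Six vertices are what \<open>3 \<le> n div 2\<close> demands in the definition
    of a bipartition; the first two groups supply them.\<close>
  ultimately have card: "6 \<le> card (verts G)"
    using a12 b1 assms(4) bij_betw_same_card[OF h] by simp
  obtain w :: "nat \<times> (nat + nat) \<Rightarrow> nat \<Rightarrow> real" and T where T: "T \<noteq> 0"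
    and frame: "\<And>j k. j < 3 \<Longrightarrow> k < 3 \<Longrightarrow> (\<Sum>u\<in>V. w u j * w u k) = (if j = k then T else 0)"
    and adj: "\<And>u v. u \<in> V \<Longrightarrow> v \<in> V \<Longrightarrow> u \<noteq> v \<Longrightarrow>
       (\<Sum>k<3. w u k * w v k) \<noteq> 0 \<longleftrightarrow>
         (fst u = fst v \<longrightarrow> isl (snd u) = isl (snd v)) \<and>
         {u, v} \<notin> {{(1, Inl p), (2, Inl q)}, {(1, Inl p'), (2, Inl q')}}"
    unfolding V_def by (rule dotted_join_tight_frame[OF assms(1) a b pq]) blast+
  have ach3: "achieves_bipartition G 3"
  proof (rule tight_frame_achieves_bipartition[OF fin _ _ T, where w = "w \<circ> h"])
    fix j k :: nat assume "j < 3" "k < 3"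
    then show "(\<Sum>u\<in>verts G. (w \<circ> h) u j * (w \<circ> h) u k) = (if j = k then T else 0)"
      using frame sum.reindex_bij_betw[OF h, of "\<lambda>u. w u j * w u k"] by simp
  next
    fix u v assume uv: "u \<in> verts G" "v \<in> verts G" "u \<noteq> v"
    then have "h u \<in> V" "h v \<in> V" "h u \<noteq> h v" using h unfolding bij_betw_def inj_on_def by auto
    from adj[OF this] hG[OF uv]
    show "(\<Sum>k<3. (w \<circ> h) u k * (w \<circ> h) v k) \<noteq> 0 \<longleftrightarrow> {u, v} \<in> edges G" by simp
  qed (use card in auto)
  define g where "g = inv_into (verts G) h"
  have g: "g s \<in> verts G" "h (g s) = s" if "s \<in> V" for s
    using that h unfolding g_def bij_betw_def by (auto simp: inv_into_into f_inv_into_f)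
  have gG: "{g s, g t} \<in> edges G \<longleftrightarrow>
         (fst s = fst t \<longrightarrow> isl (snd s) = isl (snd t)) \<and>
         {s, t} \<notin> {{(1, Inl p), (2, Inl q)}, {(1, Inl p'), (2, Inl q')}}" and gne: "g s \<noteq> g t"
    if "s \<in> V" "t \<in> V" "s \<noteq> t" for s t
  proof -
    show "g s \<noteq> g t" using g that by metis
    with hG[OF g(1)[OF that(1)] g(1)[OF that(2)]] that show "{g s, g t} \<in> edges G \<longleftrightarrow>
         (fst s = fst t \<longrightarrow> isl (snd s) = isl (snd t)) \<and>
         {s, t} \<notin> {{(1, Inl p), (2, Inl q)}, {(1, Inl p'), (2, Inl q')}}"
      by (simp add: g)
  qed
  \<comment> \<open>\<open>?x\<close> and \<open>?y\<close> span a removed edge, and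
    \<open>?z\<close> is nonadjacent to the whole clique of \<open>?x\<close>. The pair
    \<open>?x'\<close>, \<open>?y\<close> mixes endpoints of the two removed edges and so is still
    an edge, which dimension at most 2 would forbid.\<close>
  let ?x = "(1, Inl p) :: nat \<times> (nat + nat)" and ?x' = "(1, Inl p') :: nat \<times> (nat + nat)"
  let ?y = "(2, Inl q) :: nat \<times> (nat + nat)" and ?z = "(1, Inr 0) :: nat \<times> (nat + nat)"
  have V: "?x \<in> V" "?x' \<in> V" "?y \<in> V" "?z \<in> V"
    using pq b1 assms(1) unfolding V_def by auto
  have E: "{g ?x, g ?x'} \<in> edges G" "{g ?z, g ?y} \<in> edges G" "{g ?x', g ?y} \<in> edges G"
    and nE: "{g ?x, g ?z} \<notin> edges G" "{g ?x', g ?z} \<notin> edges G" "{g ?x, g ?y} \<notin> edges G"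
    using pq V by (simp_all add: gG doubleton_eq_iff)
  have not_ach: "\<not> achieves_bipartition G k" if "k \<le> 2" for k
  proof
    assume "achieves_bipartition G k"
    then obtain r :: "'v \<Rightarrow> nat \<Rightarrow> real" where
      r: "\<And>u v. u \<in> verts G \<Longrightarrow> v \<in> verts G \<Longrightarrow> u \<noteq> v \<Longrightarrow>
        (\<Sum>i<k. r u i * r v i) \<noteq> 0 \<longleftrightarrow> {u, v} \<in> edges G"
      by (rule achieves_bipartition_representation) blast
    have r': "(\<Sum>i<k. r (g s) i * r (g t) i) = 0 \<longleftrightarrow> {g s, g t} \<notin> edges G"
      if "s \<in> V" "t \<in> V" "s \<noteq> t" for s t
      using r[OF g(1)[OF that(1)] g(1)[OF that(2)] gne[OF that]] by blast
    have "(\<Sum>i<k. r (g ?x') i * r (g ?y) i) = 0"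
    proof (rule orthogonality_rank_le_2[OF that])
      show "(\<Sum>i<k. r (g ?x) i * r (g ?z) i) = 0" "(\<Sum>i<k. r (g ?x') i * r (g ?z) i) = 0"
        "(\<Sum>i<k. r (g ?x) i * r (g ?y) i) = 0" "(\<Sum>i<k. r (g ?x) i * r (g ?x') i) \<noteq> 0"
        "(\<Sum>i<k. r (g ?z) i * r (g ?y) i) \<noteq> 0"
        using E nE pq V by (simp_all add: r' del: One_nat_def)
    qed
    then show False using E(3) r'[OF V(2,3)] by simp
  qed
  have "MB G = 3"
    unfolding MB_def using ach3 not_ach
    by (intro Least_equality) (auto simp: not_less_eq_eq[symmetric] numeral_3_eq_3 numeral_2_eq_2)
  moreover have "min_num_eigenvalues G = 2"
    unfolding min_num_eigenvalues_def
  proof (rule Least_equality)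
    show "\<exists>A\<in>sym_matrices G. num_eigenvalues A = 2"
      using ach3 unfolding achieves_bipartition_def num_eigenvalues_def by (metis card_2_iff)
  next
    fix m assume "\<exists>A\<in>sym_matrices G. num_eigenvalues A = m"
    then show "2 \<le> m"
      \<comment> \<open>Any edge rules out a single eigenvalue; the one inside the first clique
        between the endpoints of the removed edges is at hand.\<close>
      using sym_matrices_num_eigenvalues_ge_2[OF _ E(1)] gne[of ?x ?x'] g V pq by auto
  qed
  ultimately show ?thesis by simp
qed

end
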